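(* Let $m,n\ge1$, let $P\in\mathfrak{D}_n^{(1,m)}$ have step sequence $\mathfrak{u}_P=(u_1,\ldots,u_n)$, and let $\mathfrak{a}=\alpha^I(P)=(a_1,\ldots,a_m)$ be its $m$-tuple of Dyck words of type $I$. The rotation on $\mathfrak{a}$ is equivalent to the rotation on $\mathfrak{u}_P$: for every $i\in[2,n]$ with $u_{i-1}<u_i$, if $P'$ is the path obtained from $P$ by rotation at position $i$, then $\alpha^I(P')$ is the $m$-tuple obtained from $\mathfrak{a}$ by the rotation of $\mathfrak{a}$ at $i$.
   Context: **Dyck paths.** $\mathfrak{D}_n^{(1,m)}$ is the set of lattice paths from $(0,0)$ to $(mn,n)$ with unit steps $N=(0,1)$, $E=(1,0)$ staying weakly above $y=x/m$. The step sequence is $\mathfrak{u}_P=(u_1,\ldots,u_n)$, $u_k$ being the $x$-coordinate of the $k$-th $N$ step; it is weakly increasing with $0\le u_k\le m(k-1)$ and determines $P$. **Rotation of $P$ at position $i$** (for $u_{i-1}<u_i$). Let $k\ge i$ be the unique index with $u_j-u_i<m(j-i)$ for all $j\in[i+1,k]$ and either $k=n$ or $u_{k+1}-u_i\ge m(k+1-i)$. The rotated path $P'$ has step sequence $(u_1,\ldots,u_{i-1},u_i-1,\ldots,u_k-1,u_{k+1},\ldots,u_n)$. **Parenthesis presentation.** $\pi(P)$ is the $m$-Stirling permutation obtained by starting with the empty word and, for $k=1,\ldots,n$, inserting $k^m$ right after the first $u_k$ letters of the current word. For a word $\pi$ in which each occurring letter occurs exactly $m$ times and no letter smaller than $i$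 occurs between two $i$'s, put $\alpha^\ast(\emptyset)=\emptyset$ and, if $r$ is the smallest letter and $\pi=\pi^0r\pi^1r\cdots r\pi^m$, $\alpha^\ast(\pi)=(\,\alpha^\ast(\pi^0)\ast\alpha^\ast(\pi^1)\ast\cdots\ast\alpha^\ast(\pi^m)\,)$. The $m$ displayed stars belong to the displayed left parenthesis and are labeled $1,\ldots,m$ from right to left. Write $\alpha^\ast(P)=\alpha^\ast(\pi(P))$. **Type $I$.** For $1\le l\le m$, $\alpha^I_l(P)$ is obtained from $\alpha^\ast(P)$ by erasing all ")" and all stars not labeled $l$ and replacing the remaining stars by ")"; reading "(" as $N$ and ")" as $E$ it is a Dyck word of size $n$. $\alpha^I(P)=(\alpha^I_1(P),\ldots,\alpha^I_m(P))$. **Rotation of $\mathfrak{a}$ at $i$.** Let $\epsilon(i)$ be the $i$-th "(" from the left in $\alpha^\ast(P)$, and suppose the symbol immediately to its left is a star (equivalently $u_{i-1}<u_i$). Let $l_\ast$ be the label of that star and $r$ the number of stars with label $l_\ast$ to the left of $\epsilon(i)$. Let $n_1$ be the position of the star labeled $1$ belonging to $\epsilon(i)$, and $n'$ the number of left parentheses from $\epsilon(i)$ (included) to $n_1$. The rotation of $\mathfrak{a}$ keeps $a_p$ for $p\ne l_\ast$ and performs on $a_{l_\ast}$ the rotation of size $n'$ at the $r$-th $E$ step: if this $E$ step is at position $s$ in $a_{l_\ast}=x_1\cdots x_{2n}$, the new word is $x_1\cdots x_{s-1}\,x_{s+1}\cdots x_{s+2n'}\,x_s\,x_{s+2n'+1}\cdots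 x_{2n}$. *)

theory Defs
  imports Main
begin

text \<open>The mathematics numbers letters, rows and steps from 1; lists are indexed from 0.
  \<open>xs !\<^sub>1 k\<close> is the \<open>k\<close>-th entry of \<open>xs\<close> for \<open>k \<ge> 1\<close>.\<close>

abbreviation nth1 :: "'a list \<Rightarrow> nat \<Rightarrow> 'a" (infixl "!\<^sub>1" 100) where
  "xs !\<^sub>1 k \<equiv> xs ! (k - 1)"

text \<open>The 0-based position of the \<open>k\<close>-th entry (\<open>k \<ge> 1\<close>) satisfying \<open>Q\<close>.\<close>

definition nth_pos :: "('a \<Rightarrow> bool) \<Rightarrow> nat \<Rightarrow> 'a list \<Rightarrow> nat" where
  "nth_pos Q k xs = filter (\<lambda>j. Q (xs ! j)) [0..<length xs] !\<^sub>1 k"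


section \<open>Dyck paths and their rotation\<close>

datatype step = N | E

text \<open>The condition ``weakly above \<open>y = x/m\<close>'' is stated at the lattice points
  visited by the path, as \<open>x \<le> m y\<close>.\<close>

definition dyck_paths :: "nat \<Rightarrow> nat \<Rightarrow> step list set" where
  "dyck_paths m n = {P. count_list P N = n \<and> count_list P E = m * n \<and>
     (\<forall>k \<le> length P. count_list (take k P) E \<le> m * count_list (take k P) N)}"

text \<open>The \<open>x\<close>-coordinates of the \<open>N\<close> steps of a path starting at abscissa \<open>x\<close>.\<close>

primrec north_xs :: "nat \<Rightarrow> step list \<Rightarrow> nat list" where
  "north_xs x [] = []"
| "north_xs x (s # P) = (case s of N \<Rightarrow> x # north_xs x P | E \<Rightarrow> north_xs (Suc x) P)"

definition step_seq :: "step list \<Rightarrow> nat list" where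
  "step_seq P = north_xs 0 P"

text \<open>The inequalities \<open>u\<^sub>j - u\<^sub>i < m (j - i)\<close> are written additively to avoid
  truncated subtraction.\<close>

definition is_rotation_end :: "nat \<Rightarrow> nat list \<Rightarrow> nat \<Rightarrow> nat \<Rightarrow> bool" where
  "is_rotation_end m u i k \<longleftrightarrow> i \<le> k \<and> k \<le> length u \<and>
     (\<forall>j \<in> {i+1..k}. u !\<^sub>1 j < u !\<^sub>1 i + m * (j - i)) \<and>
     (k = length u \<or> u !\<^sub>1 (k+1) \<ge> u !\<^sub>1 i + m * (k + 1 - i))"

definition rotation_end :: "nat \<Rightarrow> nat list \<Rightarrow> nat \<Rightarrow> nat" where
  "rotation_end m u i = (THE k. is_rotation_end m u i k)"

definition seq_rotation :: "nat \<Rightarrow> nat \<Rightarrow> nat list \<Rightarrow> nat list" where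
  "seq_rotation m i u =
     map (\<lambda>j. if i \<le> j \<and> j \<le> rotation_end m u i then u !\<^sub>1 j - 1 else u !\<^sub>1 j)
       [1..<length u + 1]"

text \<open>The rotated path is determined by its step sequence; see \<open>path_rotation_correct\<close> below
  for existence and uniqueness.\<close>

definition path_rotation :: "nat \<Rightarrow> nat \<Rightarrow> nat \<Rightarrow> step list \<Rightarrow> step list" where
  "path_rotation m n i P =
     (THE P'. P' \<in> dyck_paths m n \<and> step_seq P' = seq_rotation m i (step_seq P))"


section \<open>The parenthesis presentation\<close>

definition stirling_word :: "nat \<Rightarrow> nat list \<Rightarrow> nat list" where
  "stirling_word m u =
     foldl (\<lambda>w k. take (u !\<^sub>1 k) w @ replicate m k @ drop (u !\<^sub>1 k) w) [] [1..<length u + 1]"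

text \<open>\<open>blocks r w\<close> is the list of factors \<open>[w\<^sup>0, w\<^sup>1, \<dots>]\<close> with
  \<open>w = w\<^sup>0 r w\<^sup>1 r \<dots>\<close> and no factor containing \<open>r\<close>.\<close>

primrec blocks :: "nat \<Rightarrow> nat list \<Rightarrow> nat list list" where
  "blocks r [] = [[]]"
| "blocks r (x # w) = (if x = r then [] # blocks r w
     else (x # hd (blocks r w)) # tl (blocks r w))"

lemma blocks_ne: "blocks r w \<noteq> []"
  by (induction w) auto

lemma blocks_length_le: "b \<in> set (blocks r w) \<Longrightarrow> length b \<le> length w"
proof (induction w arbitrary: b)
  case (Cons x w)
  have "hd (blocks r w) \<in> set (blocks r w)" using blocks_ne by simp
  moreover have "set (tl (blocks r w)) \<subseteq> set (blocks r w)" by (cases "blocks r w") auto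
  ultimately show ?case using Cons by (auto split: if_splits simp: le_SucI)
qed simp

lemma blocks_length_less: "r \<in> set w \<Longrightarrow> b \<in> set (blocks r w) \<Longrightarrow> length b < length w"
proof (induction w arbitrary: b)
  case (Cons x w)
  have h: "hd (blocks r w) \<in> set (blocks r w)" using blocks_ne by simp
  have t: "set (tl (blocks r w)) \<subseteq> set (blocks r w)" by (cases "blocks r w") auto
  show ?case
  proof (cases "x = r")
    case True
    then show ?thesis using Cons.prems blocks_length_le[of b r w] by (auto simp: le_imp_less_Suc)
  next
    case False
    then show ?thesis using Cons h t by (auto simp: less_SucI)
  qed
qed simp

lemma length_blocks: "length (blocks r w) = count_list w r + 1"
proof (induction w)
  case (Cons x w)
  then show ?case using blocks_ne[of r w] by (cases "blocks r w") auto
qed simp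

text \<open>Each parenthesis symbol carries the letter that creates it, which encodes the relation
  ``this star belongs to that left parenthesis''; \<open>Star r l\<close> has label \<open>l\<close>.\<close>

datatype psym = LPar nat | RPar nat | Star nat nat

text \<open>In a word whose letters all occur \<open>m\<close> times, \<open>length bs - 1 = m\<close> below (\<open>length_blocks\<close>),
  so the stars receive the labels \<open>m, \<dots>, 1\<close> from left to right.\<close>

function alpha_star :: "nat list \<Rightarrow> psym list" where
  "alpha_star w =
     (if w = [] then []
      else let r = Min (set w); bs = blocks r w; m = length bs - 1
        in LPar r # alpha_star (bs ! 0)
           @ concat (map (\<lambda>p. Star r (m + 1 - p) # alpha_star (bs ! p)) [1..<m + 1])
           @ [RPar r])"
  by pat_completeness auto
termination
proof (relation "measure length")
  fix w :: "nat list" and r bs assume w: "w \<noteq> []" and r: "r = Min (set w)" and bs: "bs = blocks r w"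
  have "r \<in> set w" using w r by simp
  then show "(bs ! 0, w) \<in> measure length"
    using blocks_length_less bs blocks_ne[of r w] by simp
next
  fix w :: "nat list" and r bs m p
  assume w: "w \<noteq> []" and r: "r = Min (set w)" and bs: "bs = blocks r w"
    and m: "m = length bs - 1" and p: "p \<in> set [1..<m + 1]"
  have "r \<in> set w" using w r by simp
  moreover have "p < length bs" using m p by auto
  ultimately show "(bs ! p, w) \<in> measure length"
    using blocks_length_less bs by simp
qed simp

declare alpha_star.simps [simp del]

definition parens :: "nat \<Rightarrow> step list \<Rightarrow> psym list" where
  "parens m P = alpha_star (stirling_word m (step_seq P))"


section \<open>Type I tuples and their rotation\<close>

fun type_I_letter :: "nat \<Rightarrow> psym \<Rightarrow> step list" where
  "type_I_letter l (LPar r) = [N]"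
| "type_I_letter l (RPar r) = []"
| "type_I_letter l (Star r l') = (if l' = l then [E] else [])"

definition alpha_I_comp :: "nat \<Rightarrow> nat \<Rightarrow> step list \<Rightarrow> step list" where
  "alpha_I_comp m l P = concat (map (type_I_letter l) (parens m P))"

definition alpha_I :: "nat \<Rightarrow> step list \<Rightarrow> step list list" where
  "alpha_I m P = map (\<lambda>l. alpha_I_comp m l P) [1..<m + 1]"

definition word_rotation :: "nat \<Rightarrow> nat \<Rightarrow> step list \<Rightarrow> step list" where
  "word_rotation n' r x =
     (let s = nth_pos (\<lambda>c. c = E) r x
      in take s x @ take (2 * n') (drop (s + 1) x) @ [x ! s] @ drop (s + 1 + 2 * n') x)"

fun is_LPar :: "psym \<Rightarrow> bool" where
  "is_LPar (LPar r) = True"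
| "is_LPar _ = False"

fun has_label :: "nat \<Rightarrow> psym \<Rightarrow> bool" where
  "has_label l (Star r l') = (l' = l)"
| "has_label l _ = False"

definition size_of_rotation :: "psym list \<Rightarrow> nat \<Rightarrow> nat" where
  "size_of_rotation w e =
     (let r = (THE r. w ! e = LPar r);
          n1 = (THE j. j < length w \<and> w ! j = Star r 1)
      in card {j. e \<le> j \<and> j \<le> n1 \<and> is_LPar (w ! j)})"

text \<open>\<open>tuple_rotation w i a\<close> is the rotation at \<open>i\<close> of the tuple \<open>a\<close> read off the
  parenthesis word \<open>w\<close>; it is unspecified unless the symbol left of the \<open>i\<close>-th left
  parenthesis is a star.\<close>

definition tuple_rotation :: "psym list \<Rightarrow> nat \<Rightarrow> step list list \<Rightarrow> step list list" where
  "tuple_rotation w i a =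
     (let e = nth_pos is_LPar i w
      in case w ! (e - 1) of
           Star _ l \<Rightarrow>
             a[l - 1 := word_rotation (size_of_rotation w e)
                          (length (filter (has_label l) (take e w))) (a !\<^sub>1 l)]
         | _ \<Rightarrow> undefined)"


section \<open>The rotated path is well defined\<close>

lemma rotation_end_ex1:
  assumes "1 \<le> i" "i \<le> length u"
  shows "\<exists>!k. is_rotation_end m u i k"
proof -
  let ?ok = "\<lambda>j. u !\<^sub>1 j < u !\<^sub>1 i + m * (j - i)"
  have ex: "\<exists>k. is_rotation_end m u i k"
  proof (cases "\<forall>j \<in> {i+1..length u}. ?ok j")
    case True
    then show ?thesis using assms by (intro exI[of _ "length u"]) (auto simp: is_rotation_end_def)
  next
    case False
    define b where "b = (LEAST j. j \<in> {i+1..length u} \<and> \<not> ?ok j)"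
    have b: "b \<in> {i+1..length u} \<and> \<not> ?ok b"
      unfolding b_def by (rule LeastI_ex) (use False in blast)
    have lt: "?ok j" if "j \<in> {i+1..b - 1}" for j
    proof -
      have "j < b" using that by auto
      then have "\<not> (j \<in> {i+1..length u} \<and> \<not> ?ok j)"
        unfolding b_def by (rule not_less_Least)
      then show ?thesis using that b by auto
    qed
    have "b - 1 + 1 = b" using b by auto
    then show ?thesis using b lt
      by (intro exI[of _ "b - 1"]) (auto simp: is_rotation_end_def simp del: One_nat_def)
  qed
  have no: "\<not> k < k'" if "is_rotation_end m u i k" "is_rotation_end m u i k'" for k k'
  proof
    assume "k < k'"
    then have "k + 1 \<in> {i+1..k'}" "k \<noteq> length u" using that by (auto simp: is_rotation_end_def)
    then show False using that unfolding is_rotation_end_def by (meson leD)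
  qed
  show ?thesis using ex no by (meson linorder_neqE_nat)
qed

lemma north_xs_ge: "x \<in> set (north_xs c P) \<Longrightarrow> c \<le> x"
  by (induction P arbitrary: c) (fastforce split: step.splits)+

lemma north_xs_sorted: "sorted (north_xs c P)"
  by (induction P arbitrary: c) (auto split: step.splits dest: north_xs_ge)

lemma length_north_xs: "length (north_xs c P) = count_list P N"
  by (induction P arbitrary: c) (auto split: step.splits)

lemma north_xs_inj:
  "north_xs c P = north_xs c Q \<Longrightarrow> count_list P E = count_list Q E \<Longrightarrow> P = Q"
proof (induction P arbitrary: c Q)
  case Nil
  then show ?case by (cases Q) (auto split: step.splits if_splits)
next
  case (Cons s P)
  show ?case
  proof (cases Q)
    case Nil
    then show ?thesis using Cons.prems by (auto split: step.splits)
  next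
    case (Cons t R)
    have no: "c # xs \<noteq> north_xs (Suc c) S" for xs S
    proof
      assume "c # xs = north_xs (Suc c) S"
      then have "c \<in> set (north_xs (Suc c) S)" by (metis list.set_intros(1))
      then show False using north_xs_ge by fastforce
    qed
    show ?thesis
      using Cons.IH[of c R] Cons.IH[of "Suc c" R] Cons.prems no no[symmetric]
      unfolding Cons by (cases s; cases t) auto
  qed
qed

lemma north_xs_bound:
  assumes "\<forall>k \<le> length P. c + count_list (take k P) E \<le> m * (y + count_list (take k P) N)"
  shows "\<forall>j < count_list P N. north_xs c P ! j \<le> m * (y + j)"
  using assms
proof (induction P arbitrary: c y)
  case (Cons s P)
  show ?case
  proof (cases s)
    case N
    have "\<forall>k \<le> length P. c + count_list (take k P) E \<le> m * (Suc y + count_list (take k P) N)"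
      using Cons.prems N by (auto dest: spec[where x = "Suc _"])
    from Cons.IH[OF this] have "\<forall>j < count_list P N. north_xs c P ! j \<le> m * (Suc y + j)" .
    moreover have "c \<le> m * y" using Cons.prems[rule_format, of 0] by simp
    ultimately show ?thesis using N by (auto simp: nth_Cons split: nat.splits)
  next
    case E
    have "\<forall>k \<le> length P. Suc c + count_list (take k P) E \<le> m * (y + count_list (take k P) N)"
      using Cons.prems E by (auto dest: spec[where x = "Suc _"])
    from Cons.IH[OF this] show ?thesis using E by simp
  qed
qed simp

lemma dyck_of_north_xs:
  assumes "\<forall>j < count_list P N. north_xs c P ! j \<le> m * (y + j)"
    and "c \<le> m * y" and "c + count_list P E \<le> m * (y + count_list P N)"
  shows "k \<le> length P \<Longrightarrow> c + count_list (take k P) E \<le> m * (y + count_list (take k P) N)"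
  using assms
proof (induction P arbitrary: c y k)
  case (Cons s P)
  show ?case
  proof (cases k)
    case 0
    then show ?thesis using Cons.prems by simp
  next
    case (Suc k')
    show ?thesis
    proof (cases s)
      case N
      have "\<forall>j < count_list P N. north_xs c P ! j \<le> m * (Suc y + j)"
        using Cons.prems(2) N by (auto dest: spec[where x = "Suc _"])
      then show ?thesis
        using Cons.IH[of k' c "Suc y"] Cons.prems N Suc by simp
    next
      case E
      have "Suc c \<le> m * y"
      proof (cases "count_list P N = 0")
        case True
        then show ?thesis using Cons.prems(4) E by simp
      next
        case False
        then have "north_xs (Suc c) P ! 0 \<in> set (north_xs (Suc c) P)"
          using length_north_xs by (metis nth_mem neq0_conv)
        then have "Suc c \<le> north_xs (Suc c) P ! 0" by (rule north_xs_ge)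
        moreover have "north_xs (Suc c) P ! 0 \<le> m * y"
          using False Cons.prems(2) E by (auto dest: spec[where x = 0])
        ultimately show ?thesis by simp
      qed
      then show ?thesis
        using Cons.IH[of k' "Suc c" y] Cons.prems E Suc by simp
    qed
  qed
qed simp

lemma north_xs_replicate: "north_xs c (replicate k E @ P) = north_xs (c + k) P"
  by (induction k arbitrary: c) auto

lemma count_list_replicate: "count_list (replicate k x) y = (if x = y then k else 0)"
  by (induction k) auto

lemma north_xs_surj:
  assumes "sorted v" "\<forall>x \<in> set v. c \<le> x \<and> x \<le> M" "c \<le> M"
  shows "\<exists>P. north_xs c P = v \<and> c + count_list P E = M"
  using assms
proof (induction v arbitrary: c)
  case Nil
  show ?case
    using Nil north_xs_replicate[of c "M - c" "[]"]
    by (intro exI[of _ "replicate (M - c) E"]) (auto simp: count_list_replicate)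
next
  case (Cons a v)
  from Cons.IH[of a] Cons.prems obtain P where "north_xs a P = v" "a + count_list P E = M" by auto
  then show ?case using Cons.prems
    by (intro exI[of _ "replicate (a - c) E @ N # P"])
      (auto simp: north_xs_replicate count_list_replicate)
qed

lemma step_seq_dyck:
  assumes "P \<in> dyck_paths m n"
  shows "sorted (step_seq P)" "length (step_seq P) = n"
    "\<And>k. k \<in> {1..n} \<Longrightarrow> step_seq P !\<^sub>1 k \<le> m * (k - 1)"
  using assms north_xs_bound[of P 0 m 0]
  by (auto simp: step_seq_def dyck_paths_def north_xs_sorted length_north_xs)

lemma dyck_path_ex1:
  assumes "sorted v" "length v = n" "\<And>k. k \<in> {1..n} \<Longrightarrow> v !\<^sub>1 k \<le> m * (k - 1)"
  shows "\<exists>!P. P \<in> dyck_paths m n \<and> step_seq P = v"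
proof -
  have b: "v ! j \<le> m * j" if "j < n" for j using assms(3)[of "Suc j"] that by simp
  have "x \<le> m * n" if x: "x \<in> set v" for x
  proof -
    obtain j where j: "j < n" "x = v ! j" using x assms(2) by (auto simp: in_set_conv_nth)
    have "m * j \<le> m * n" using j by simp
    then show ?thesis using b[OF j(1)] j(2) by linarith
  qed
  then obtain P where P: "north_xs 0 P = v" "count_list P E = m * n"
    using north_xs_surj[of v 0 "m * n"] assms(1) by auto
  have cN: "count_list P N = n" using length_north_xs[of 0 P] P assms(2) by simp
  have "P \<in> dyck_paths m n"
    using dyck_of_north_xs[of P 0 m 0] P cN b by (auto simp: dyck_paths_def)
  then show ?thesis using P north_xs_inj
    by (intro ex1I[of _ P]) (auto simp: step_seq_def dyck_paths_def)
qed

theorem path_rotation_correct: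
  assumes P: "P \<in> dyck_paths m n" and i: "i \<in> {2..n}"
    and lt: "step_seq P !\<^sub>1 (i - 1) < step_seq P !\<^sub>1 i"
  shows "path_rotation m n i P \<in> dyck_paths m n"
    and "step_seq (path_rotation m n i P) = seq_rotation m i (step_seq P)"
proof -
  define u where "u = step_seq P"
  define v where "v = seq_rotation m i u"
  define k where "k = rotation_end m u i"
  note u = step_seq_dyck[OF P, folded u_def]
  have v_nth: "v ! j = (if i \<le> j + 1 \<and> j + 1 \<le> k then u ! j - 1 else u ! j)" if "j < n" for j
    using that u(2) by (simp del: upt_Suc add: v_def k_def seq_rotation_def)
  have len: "length v = n" using u(2) by (simp add: v_def seq_rotation_def)
  have le: "u ! a \<le> u ! b" if "a \<le> b" "b < n" for a b
    using that u by (simp add: sorted_nth_mono)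
  have "v ! a \<le> v ! b" if "a \<le> b" "b < n" for a b
  proof (cases "a + 1 < i \<and> i \<le> b + 1")
    case True
    then have "u ! a \<le> u ! (i - 2)" "u ! (i - 1) \<le> u ! b" using that i by (auto intro!: le)
    moreover have "u ! (i - 2) < u ! (i - 1)"
    proof -
      have "i - 1 - 1 = i - 2" by simp
      then show ?thesis using lt unfolding u_def by argo
    qed
    moreover have "v ! a = u ! a" using that True v_nth[of a] by simp
    moreover have "v ! b = u ! b \<or> v ! b = u ! b - 1" using that v_nth[of b] by simp
    ultimately show ?thesis by linarith
  next
    case False
    have "v ! a = (if i \<le> a + 1 \<and> a + 1 \<le> k then u ! a - 1 else u ! a)"
      and "v ! b = (if i \<le> b + 1 \<and> b + 1 \<le> k then u ! b - 1 else u ! b)"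
      and "u ! a \<le> u ! b"
      using that v_nth le by auto
    then show ?thesis using that(1) False by (simp split: if_splits; linarith)
  qed
  then have "sorted v" by (auto simp: sorted_iff_nth_mono len)
  moreover have "v !\<^sub>1 j \<le> m * (j - 1)" if "j \<in> {1..n}" for j
    using that u(3)[OF that] v_nth[of "j - 1"] by (auto split: if_splits)
  ultimately have "\<exists>!Q. Q \<in> dyck_paths m n \<and> step_seq Q = v"
    using len dyck_path_ex1 by blast
  then have "path_rotation m n i P \<in> dyck_paths m n \<and> step_seq (path_rotation m n i P) = v"
    unfolding path_rotation_def v_def u_def by (rule theI')
  then show "path_rotation m n i P \<in> dyck_paths m n"
    and "step_seq (path_rotation m n i P) = seq_rotation m i (step_seq P)"
    by (auto simp: v_def u_def)
qed

end

theory Submission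
  imports Defs
begin

text \<open>
  Why rotating the path is rotating one Dyck word of the tuple. Right parentheses contribute
  nothing to the type I words, so they can be erased from \<open>\<alpha>\<^sup>*(P)\<close>. What remains is built one letter
  at a time: to add the letter \<open>k\<close>, insert the group consisting of the left parenthesis of \<open>k\<close> and
  its \<open>m\<close> stars immediately before the star that has exactly \<open>u\<^sub>k\<close> stars to its left, or at the end
  (\<open>core_stirling_word\<close>). Indeed every letter of the Stirling permutation is represented by one
  star, so that ``after \<open>u\<^sub>k\<close> letters'' becomes ``after \<open>u\<^sub>k\<close> stars'', and the new largest letter
  opens its parenthesis as deep as possible, after all left parentheses at the same place.

  Now compare the insertions for \<open>u\<close> and for its rotation \<open>u'\<close> at \<open>i\<close>
  (\<open>insertions_rotation\<close>). They agree before step \<open>i\<close>. Since \<open>u\<^sub>i > u\<^sub>i\<^sub>-\<^sub>1\<close>, the place for the group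
  of \<open>i\<close> is directly to the right of a star \<open>\<sigma>\<close>, and for \<open>u'\<close> it is directly to the left of \<open>\<sigma>\<close>:
  the words are \<open>x \<sigma> b y\<close> and \<open>x b \<sigma> y\<close>. The factor \<open>b\<close>, from the left parenthesis to the last
  star of \<open>i\<close>, has \<open>m (j - i)\<close> stars before step \<open>j\<close>, so the inequalities
  \<open>u\<^sub>j - u\<^sub>i < m (j - i)\<close> which define the end \<open>k\<close> of the rotation say exactly that the groups of
  \<open>i + 1, \<dots>, k\<close> go inside \<open>b\<close>; lowering their positions by 1 compensates the missing star to the
  left of \<open>b\<close>. All later groups go to the right of \<open>x \<sigma> b\<close>, respectively \<open>x b \<sigma>\<close>,
  to the same place of \<open>y\<close> because both factors have the same number of stars.

  Hence the rotation moves the single star \<open>\<sigma>\<close> across \<open>b\<close>. The factor \<open>b\<close> contains \<open>k - i + 1\<close> left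
  parentheses and as many stars of each label, so in the component given by the label of \<open>\<sigma>\<close> an
  \<open>E\<close> step moves across \<open>2 (k - i + 1)\<close> letters, and the other components do not change. This is
  the rotation of the tuple (\<open>tuple_rotation_moves_star\<close>).
\<close>

section \<open>The parenthesis word without right parentheses\<close>

fun is_Star :: "psym \<Rightarrow> bool" where
  "is_Star (Star r l) = True"
| "is_Star _ = False"

fun is_RPar :: "psym \<Rightarrow> bool" where
  "is_RPar (RPar r) = True"
| "is_RPar _ = False"

lemma is_Star_not_LPar: "is_Star a \<Longrightarrow> \<not> is_LPar a"
  by (cases a) auto

abbreviation stars :: "psym list \<Rightarrow> nat" where
  "stars w \<equiv> length (filter is_Star w)"

text \<open>The part of \<open>\<alpha>\<^sup>*\<close> between the parentheses of \<open>r\<close>. Labels decrease from left to right, so the label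
  of a star is the number of blocks that follow it; this makes the recursion structural in the list
  of blocks.\<close>

primrec join :: "nat \<Rightarrow> nat list list \<Rightarrow> psym list" where
  "join r [] = []"
| "join r (b # bs) = alpha_star b @ (if bs = [] then [] else Star r (length bs) # join r bs)"

lemma join_eq_concat:
  "alpha_star b @ concat (map (\<lambda>p. Star r (length bs + 1 - p) # alpha_star ((b # bs) ! p)) [1..<length bs + 1])
    = join r (b # bs)"
proof (induction bs arbitrary: b)
  case (Cons c bs)
  have "[1..<length (c # bs) + 1] = 1 # map Suc [1..<length bs + 1]"
    by (simp add: map_Suc_upt upt_conv_Cons del: upt_Suc)
  then show ?case using Cons.IH[of c] by (simp add: comp_def del: upt_Suc)
qed simp

lemma alpha_star_Nil: "alpha_star [] = []"
  by (simp add: alpha_star.simps)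

lemma alpha_star_join:
  assumes "w \<noteq> []"
  shows "alpha_star w = LPar (Min (set w)) # join (Min (set w)) (blocks (Min (set w)) w) @ [RPar (Min (set w))]"
proof -
  let ?r = "Min (set w)"
  obtain b bs where bs: "blocks ?r w = b # bs" using blocks_ne by (cases "blocks ?r w") auto
  show ?thesis
    using assms join_eq_concat[of b ?r bs] by (subst alpha_star.simps) (simp add: bs Let_def del: upt_Suc)
qed

text \<open>Cutting a word at an arbitrary place cuts exactly one of its blocks. This locates the insertion of
  a letter larger than \<open>r\<close> inside a single block.\<close>

lemma blocks_append:
  "blocks r (x @ y) = butlast (blocks r x) @ (last (blocks r x) @ hd (blocks r y)) # tl (blocks r y)"
proof (induction x)
  case Nil
  show ?case using blocks_ne[of r y] by simp
next
  case (Cons a x)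
  then show ?case using blocks_ne[of r x] by (cases "blocks r x") auto
qed

lemma blocks_avoid: "r \<notin> set w \<Longrightarrow> blocks r w = [w]"
  by (induction w) auto

lemma length_eq_blocks: "length w = sum_list (map length (blocks r w)) + (length (blocks r w) - 1)"
proof (induction w)
  case (Cons x w)
  then show ?case using blocks_ne[of r w] by (cases "blocks r w") auto
qed simp

lemma set_blocks: "b \<in> set (blocks r w) \<Longrightarrow> set b \<subseteq> set w"
proof (induction w arbitrary: b)
  case (Cons x w)
  show ?case
  proof (cases "blocks r w")
    case (Cons c cs)
    then show ?thesis using Cons.IH Cons.prems by (fastforce split: if_splits)
  qed (simp add: blocks_ne)
qed simp

text \<open>Besides being invisible in the type I words, right parentheses have to go because a rotation does
  not move them together with the block of the rotated letter: for \<open>m = 1\<close> the rotation at 2 of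
  \<open>(0, 1, 2)\<close> replaces \<open>(*(*(*)))\<close> by \<open>((*)*(*))\<close>, where the parenthesis of 2 closes before that of
  3 opens.\<close>

definition core :: "nat list \<Rightarrow> psym list" where
  "core w = filter (\<lambda>x. \<not> is_RPar x) (alpha_star w)"

primrec core_join :: "nat \<Rightarrow> nat list list \<Rightarrow> psym list" where
  "core_join r [] = []"
| "core_join r (b # bs) = core b @ (if bs = [] then [] else Star r (length bs) # core_join r bs)"

lemma filter_join: "filter (\<lambda>x. \<not> is_RPar x) (join r bs) = core_join r bs"
  by (induction bs) (auto simp: core_def)

lemma core_Nil: "core [] = []"
  by (simp add: core_def alpha_star_Nil)

lemma core_nonempty:
  assumes "w \<noteq> []"
  shows "core w = LPar (Min (set w)) # core_join (Min (set w)) (blocks (Min (set w)) w)"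
  using assms by (simp add: core_def alpha_star_join filter_join)

lemma stars_core: "stars (core w) = length w"
proof (induction w rule: length_induct)
  case (1 w)
  show ?case
  proof (cases "w = []")
    case False
    let ?r = "Min (set w)"
    have "stars (core b) = length b" if "b \<in> set (blocks ?r w)" for b
      using 1 blocks_length_less[OF _ that] False by simp
    then have "stars (core_join ?r bs) = sum_list (map length bs) + (length bs - 1)"
      if "set bs \<subseteq> set (blocks ?r w)" for bs
      using that by (induction bs) (auto simp: Suc_diff_Suc)
    then show ?thesis using False length_eq_blocks[of w ?r] by (simp add: core_nonempty)
  qed (simp add: core_Nil)
qed

section \<open>Adding a letter is inserting a group\<close>

text \<open>The insertion takes place before the star with exactly \<open>c\<close> predecessors among the stars (at the
  end if there is none); in a word of left parentheses and stars this is to the right of all left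
  parentheses between it and the previous star.\<close>

primrec insert_group :: "nat \<Rightarrow> psym list \<Rightarrow> psym list \<Rightarrow> psym list" where
  "insert_group c g [] = g"
| "insert_group c g (x # w) = (if is_Star x then (if c = 0 then g @ x # w else x # insert_group (c - 1) g w)
     else x # insert_group c g w)"

lemma insert_group_append_right: "stars x \<le> c \<Longrightarrow> insert_group c g (x @ y) = x @ insert_group (c - stars x) g y"
  by (induction x arbitrary: c) auto

lemma insert_group_append_left:
  "c \<le> stars x \<Longrightarrow> y = [] \<or> is_Star (hd y) \<Longrightarrow> insert_group c g (x @ y) = insert_group c g x @ y"
proof (induction x arbitrary: c)
  case Nil
  then show ?case by (cases y) auto
qed auto

lemma insert_group_append_inside: "c < stars x \<Longrightarrow> insert_group c g (x @ y) = insert_group c g x @ y"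
  by (induction x arbitrary: c) auto

lemma insert_group_split: "\<exists>x y. w = x @ y \<and> insert_group c g w = x @ g @ y"
proof (induction w arbitrary: c)
  case (Cons a w)
  show ?case
  proof (cases "is_Star a \<and> c = 0")
    case True
    then show ?thesis by (intro exI[of _ "[]"] exI[of _ "a # w"]) simp
  next
    case False
    obtain x y where "w = x @ y" "insert_group (if is_Star a then c - 1 else c) g w = x @ g @ y"
      using Cons by blast
    then show ?thesis using False by (intro exI[of _ "a # x"] exI[of _ y]) auto
  qed
qed auto

definition letter_group :: "nat \<Rightarrow> nat \<Rightarrow> psym list" where
  "letter_group m k = LPar k # map (Star k) (rev [1..<m + 1])"

lemma core_replicate:
  assumes "m \<ge> 1"
  shows "core (replicate m k) = letter_group m k"
proof -
  have b: "blocks k (replicate j k) = replicate (j + 1) []" for j by (induction j) auto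
  have "core_join k (replicate (j + 1) []) = map (Star k) (rev [1..<j + 1])" for j
    by (induction j) (auto simp: core_Nil)
  then show ?thesis using assms by (simp add: core_nonempty b letter_group_def del: replicate.simps)
qed

text \<open>The hypothesis is the insertion into one block. The blocks to its left contribute one star per letter and
  one separating star each. If the place is the end of the block, the next symbol is a separating star or
  the end of the word, so that inserting into the block and into the whole word agree.\<close>

lemma core_join_insert:
  assumes "core (p @ g @ q) = insert_group (length p) h (core (p @ q))"
  shows "core_join r (bs @ (p @ g @ q) # cs) =
    insert_group (sum_list (map length bs) + length bs + length p) h (core_join r (bs @ (p @ q) # cs))"
proof (induction bs)
  case Nil
  show ?case using assms by (auto simp: insert_group_append_left stars_core)
next
  case (Cons b bs)
  then show ?case by (simp add: insert_group_append_right stars_core add.assoc)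
qed

text \<open>A letter larger than all others leaves the smallest letter \<open>r\<close> in place and goes into one of the
  blocks of \<open>r\<close>, so the claim descends along the recursion for \<open>\<alpha>\<^sup>*\<close>.\<close>

lemma core_insert:
  assumes "m \<ge> 1" "\<forall>a \<in> set (x @ y). a < k"
  shows "core (x @ replicate m k @ y) = insert_group (length x) (letter_group m k) (core (x @ y))"
  using assms(2)
proof (induction "length (x @ y)" arbitrary: x y rule: less_induct)
  case less
  show ?case
  proof (cases "x @ y = []")
    case True
    then show ?thesis using assms(1) core_replicate by (simp add: core_Nil)
  next
    case False
    let ?w = "x @ replicate m k @ y"
    define r where "r = Min (set (x @ y))"
    have r: "r \<in> set (x @ y)" unfolding r_def using False by (intro Min_in) auto
    then have rk: "r < k" using less.prems by auto
    have "Min (set ?w) = r"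
    proof (rule Min_eqI)
      show "r \<le> a" if "a \<in> set ?w" for a
        using that rk by (auto simp: r_def set_replicate_conv_if split: if_splits)
      show "r \<in> set ?w" using r by auto
    qed simp
    \<comment> \<open>The cut between \<open>x\<close> and \<open>y\<close> falls into the block \<open>p @ q\<close>.\<close>
    define bs p q cs where "bs = butlast (blocks r x)" "p = last (blocks r x)"
      "q = hd (blocks r y)" "cs = tl (blocks r y)"
    have b: "blocks r (x @ y) = bs @ (p @ q) # cs"
      by (simp add: blocks_append bs_p_q_cs_def)
    have b': "blocks r ?w = bs @ (p @ replicate m k @ q) # cs"
      using rk by (simp add: blocks_append blocks_avoid bs_p_q_cs_def)
    have x: "blocks r x = bs @ [p]" by (simp add: bs_p_q_cs_def blocks_ne)
    have "core (p @ replicate m k @ q) = insert_group (length p) (letter_group m k) (core (p @ q))"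
    proof (rule less.hyps)
      have pq: "p @ q \<in> set (blocks r (x @ y))" by (simp add: b)
      show "length (p @ q) < length (x @ y)" using blocks_length_less[OF r pq] .
      show "\<forall>a \<in> set (p @ q). a < k" using set_blocks[OF pq] less.prems by blast
    qed
    from core_join_insert[OF this, of r bs cs]
    have "core_join r (blocks r ?w) = insert_group (length x) (letter_group m k) (core_join r (blocks r (x @ y)))"
      unfolding b b' using length_eq_blocks[of x r] x by (simp add: add_ac)
    moreover have "core ?w = LPar r # core_join r (blocks r ?w)"
      using core_nonempty[of ?w] \<open>Min (set ?w) = r\<close> False by simp
    moreover have "core (x @ y) = LPar r # core_join r (blocks r (x @ y))"
      using core_nonempty[of "x @ y"] False r_def by simp
    ultimately show ?thesis by simp
  qed
qed

primrec insertions :: "nat \<Rightarrow> nat list \<Rightarrow> nat \<Rightarrow> psym list" where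
  "insertions m u 0 = []"
| "insertions m u (Suc k) = insert_group (u ! k) (letter_group m (Suc k)) (insertions m u k)"

text \<open>The bound on \<open>u\<close> says that the insertion place lies within the current word, which has \<open>m * j\<close>
  letters; only then do exactly \<open>u ! j\<close> letters, hence stars, precede it.\<close>

lemma core_stirling_word:
  assumes "m \<ge> 1" "\<And>j. j < length u \<Longrightarrow> u ! j \<le> m * j"
  shows "core (stirling_word m u) = insertions m u (length u)"
proof -
  define f where "f = (\<lambda>w k. take (u !\<^sub>1 k) w @ replicate m k @ drop (u !\<^sub>1 k) w)"
  define W where "W k = foldl f [] [1..<k + 1]" for k
  have "core (W k) = insertions m u k \<and> length (W k) = m * k \<and> set (W k) \<subseteq> {1..k}"
    if "k \<le> length u" for k
    using that
  proof (induction k)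
    case 0
    show ?case by (simp add: W_def core_Nil)
  next
    case (Suc k)
    let ?x = "take (u ! k) (W k)" and ?y = "drop (u ! k) (W k)"
    have W: "W (Suc k) = ?x @ replicate m (Suc k) @ ?y" by (simp add: W_def f_def)
    from Suc have IH: "core (W k) = insertions m u k" "length (W k) = m * k" "set (W k) \<subseteq> {1..k}"
      by auto
    have lt: "\<forall>a \<in> set (?x @ ?y). a < Suc k" using IH(3) by auto
    have "length ?x = u ! k" using assms(2)[of k] Suc.prems IH(2) by simp
    then have "core (W (Suc k)) = insertions m u (Suc k)"
      using core_insert[OF assms(1) lt] IH(1) by (simp add: W)
    moreover have "length (W (Suc k)) = m * Suc k" using IH(2) W by simp
    moreover have "set (W (Suc k)) \<subseteq> {1..Suc k}"
    proof -
      have "set (W (Suc k)) \<subseteq> set (W k) \<union> {Suc k}"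
        unfolding W by (auto dest: in_set_takeD in_set_dropD)
      then show ?thesis using IH(3) by fastforce
    qed
    ultimately show ?case by blast
  qed
  from this[of "length u"] show ?thesis by (simp add: stirling_word_def W_def f_def)
qed

section \<open>The word built by insertions\<close>

lemma length_filter_insert_group:
  "length (filter Q (insert_group c g w)) = length (filter Q w) + length (filter Q g)"
  using insert_group_split[of w c g] by auto

lemma set_insert_group: "set (insert_group c g w) = set g \<union> set w"
  using insert_group_split[of w c g] by auto

lemma distinct_insert_group: "distinct (insert_group c g w) \<longleftrightarrow> distinct g \<and> distinct w \<and> set g \<inter> set w = {}"
  using insert_group_split[of w c g] by auto

lemma insert_group_0_stars: "\<forall>x \<in> set w. is_Star x \<Longrightarrow> insert_group 0 g w = g @ w"
  by (cases w) auto

lemma length_filter_group: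
  "length (filter is_LPar (letter_group m k)) = 1"
  "stars (letter_group m k) = m"
  "l \<in> {1..m} \<Longrightarrow> length (filter (has_label l) (letter_group m k)) = 1"
proof -
  have "length (filter is_LPar (map (Star k) (rev [1..<j + 1]))) = 0
      \<and> stars (map (Star k) (rev [1..<j + 1])) = j
      \<and> length (filter (has_label l) (map (Star k) (rev [1..<j + 1]))) = (if l \<in> {1..j} then 1 else 0)" for j
    by (induction j) auto
  from this[of m] show "length (filter is_LPar (letter_group m k)) = 1" "stars (letter_group m k) = m"
    "l \<in> {1..m} \<Longrightarrow> length (filter (has_label l) (letter_group m k)) = 1"
    by (simp_all add: letter_group_def del: upt_Suc)
qed

lemma stars_insertions: "stars (insertions m u k) = m * k"
  by (induction k) (simp_all add: length_filter_insert_group length_filter_group)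

lemma set_insertions:
  "set (insertions m u k) \<subseteq> LPar ` {1..k} \<union> case_prod Star ` ({1..k} \<times> {1..m})"
proof (induction k)
  case (Suc k)
  then show ?case by (fastforce simp: set_insert_group letter_group_def)
qed simp

lemma distinct_insertions: "distinct (insertions m u k)"
proof (induction k)
  case (Suc k)
  have "distinct (letter_group m (Suc k))" by (auto simp: letter_group_def distinct_map inj_on_def simp del: upt_Suc)
  moreover have "set (letter_group m (Suc k)) \<inter> set (insertions m u k) = {}"
    using set_insertions[of m u k] by (fastforce simp: letter_group_def simp del: upt_Suc)
  ultimately show ?case using Suc by (simp add: distinct_insert_group)
qed simp

text \<open>By monotonicity of \<open>u\<close>, every left parenthesis inserted so far has at most \<open>u\<^sub>k\<close> stars to its left.
  Any later place thus has all left parentheses before it and only stars behind it.\<close>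

lemma insertions_split:
  assumes "k = 0 \<or> u ! (k - 1) \<le> c" "c \<le> m * k"
    and "\<And>j. Suc j < k \<Longrightarrow> u ! j \<le> u ! Suc j" "\<And>j. j < k \<Longrightarrow> u ! j \<le> m * j"
  shows "\<exists>x y. insertions m u k = x @ y \<and> stars x = c \<and> length (filter is_LPar x) = k \<and>
    (\<forall>a \<in> set y. is_Star a)"
  using assms
proof (induction k arbitrary: c)
  case (Suc k)
  have "k = 0 \<or> u ! (k - 1) \<le> u ! k" using Suc.prems(3)[of "k - 1"] by (cases k) auto
  then obtain x y where xy: "insertions m u k = x @ y" "stars x = u ! k"
      "length (filter is_LPar x) = k" "\<forall>a \<in> set y. is_Star a"
    using Suc.IH[of "u ! k"] Suc.prems by auto
  \<comment> \<open>All stars to the right of the newest left parenthesis.\<close>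
  define t where "t = map (Star (Suc k)) (rev [1..<m + 1]) @ y"
  have t: "\<forall>a \<in> set t. is_Star a" using xy(4) by (auto simp: t_def)
  have eq: "insertions m u (Suc k) = x @ LPar (Suc k) # t"
    using xy by (simp add: insert_group_append_right insert_group_0_stars letter_group_def t_def)
  define d where "d = c - u ! k"
  have "u ! k + length t = m * Suc k"
    using stars_insertions[of m u "Suc k"] eq xy(2) t by (simp add: filter_True)
  then have d: "u ! k + d = c" "d \<le> length t" using Suc.prems(1,2) by (auto simp: d_def)
  have td: "\<forall>a \<in> set (take d t). is_Star a" "\<forall>a \<in> set (drop d t). is_Star a"
    using t by (auto dest: in_set_takeD in_set_dropD)
  have nl: "filter is_LPar (take d t) = []"
    using td(1) is_Star_not_LPar by (auto simp: filter_empty_conv)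
  show ?case
    using eq xy d td nl
    by (intro exI[of _ "x @ LPar (Suc k) # take d t"] exI[of _ "drop d t"]) (simp add: filter_True)
qed simp

section \<open>Rotating the sequence moves one star\<close>

text \<open>The shape of the factor from the left parenthesis of \<open>i\<close> to its last star once \<open>d\<close> groups lie in
  it. The bracketing by these two symbols is what the size of a tuple rotation refers to; the counts
  determine how many letters the factor contributes to each type I word.\<close>

definition rotation_block :: "nat \<Rightarrow> nat \<Rightarrow> nat \<Rightarrow> psym list \<Rightarrow> bool" where
  "rotation_block m i d b \<longleftrightarrow> (\<exists>b'. b = LPar i # b' @ [Star i 1]) \<and> length (filter is_LPar b) = d \<and>
     stars b = m * d \<and> (\<forall>l \<in> {1..m}. length (filter (has_label l) b) = d)"

lemma rotation_block_group:
  assumes "m \<ge> 1"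
  shows "rotation_block m i 1 (letter_group m i)"
proof -
  have "[1..<m + 1] = 1 # [2..<m + 1]" using assms by (simp add: upt_conv_Cons numeral_2_eq_2 del: upt_Suc)
  then have "\<exists>b'. letter_group m i = LPar i # b' @ [Star i 1]" by (simp add: letter_group_def del: upt_Suc)
  then show ?thesis using length_filter_group by (auto simp: rotation_block_def)
qed

text \<open>A place with fewer than \<open>m * d\<close> stars of the block before it precedes the last star of the block,
  so both end symbols persist.\<close>

lemma rotation_block_insert_group:
  assumes "rotation_block m i d b" "c < m * d"
  shows "rotation_block m i (Suc d) (insert_group c (letter_group m k) b)"
proof -
  obtain b' where b: "b = LPar i # b' @ [Star i 1]" using assms by (auto simp: rotation_block_def)
  then have "c \<le> stars b'" using assms by (simp add: rotation_block_def)
  then have "insert_group c (letter_group m k) b = LPar i # insert_group c (letter_group m k) b' @ [Star i 1]"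
    by (simp add: b insert_group_append_left)
  then have "\<exists>b'. insert_group c (letter_group m k) b = LPar i # b' @ [Star i 1]" by blast
  then show ?thesis
    using assms(1) unfolding rotation_block_def by (simp add: length_filter_insert_group length_filter_group)
qed

lemma insertions_cong: "(\<And>j. j < k \<Longrightarrow> u ! j = v ! j) \<Longrightarrow> insertions m u k = insertions m v k"
  by (induction k) auto

text \<open>Here \<open>p = i - 1\<close> is the index of \<open>u\<^sub>i\<close> in a list indexed from 0, and \<open>v\<close> is \<open>u\<close> lowered by 1 at the
  indices from \<open>p\<close> up to but excluding \<open>K\<close>, that is, at the positions \<open>i, \<dots>, K\<close>. The two words
  are compared in three phases: until step \<open>p\<close> they coincide; then the insertions happen inside the
  block \<open>b\<close>, which has one star more to its left for \<open>u\<close> than for \<open>v\<close>; from \<open>K\<close> on they happen to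
  the right of the block and the moved star.\<close>

lemma insertions_rotation:
  assumes m: "m \<ge> 1" and p: "0 < p" "p < K" "K \<le> length u"
    and lt: "u ! (p - 1) < u ! p"
    and sorted: "sorted u" and bound: "\<And>j. j < length u \<Longrightarrow> u ! j \<le> m * j"
    and inside: "\<And>k. p < k \<Longrightarrow> k < K \<Longrightarrow> u ! k < u ! p + m * (k - p)"
    and outside: "K < length u \<Longrightarrow> u ! p + m * (K - p) \<le> u ! K"
    and v: "\<And>j. j < length u \<Longrightarrow> v ! j = (if p \<le> j \<and> j < K then u ! j - 1 else u ! j)"
  shows "\<exists>x s l b y. insertions m u (length u) = x @ Star s l # b @ y \<and>
    insertions m v (length u) = x @ b @ Star s l # y \<and>
    length (filter is_LPar x) = p \<and> rotation_block m (Suc p) (K - p) b"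
proof -
  have mono: "u ! i \<le> u ! j" if "i \<le> j" "j < length u" for i j
    using that sorted by (simp add: sorted_nth_mono)
  have "u ! p \<le> m * p" using bound p by simp
  \<comment> \<open>Cutting one star before the insertion place exposes the star that will be moved.\<close>
  have "\<exists>x y'. insertions m u p = x @ y' \<and> stars x = u ! p - 1 \<and> length (filter is_LPar x) = p \<and>
      (\<forall>a \<in> set y'. is_Star a)"
  proof (rule insertions_split)
    show "p = 0 \<or> u ! (p - 1) \<le> u ! p - 1" using lt by linarith
    show "u ! p - 1 \<le> m * p" using \<open>u ! p \<le> m * p\<close> by linarith
    show "u ! j \<le> u ! Suc j" if "Suc j < p" for j using mono[of j "Suc j"] that p by linarith
    show "u ! j \<le> m * j" if "j < p" for j using bound[of j] that p by linarith
  qed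
  then obtain x y' where x: "insertions m u p = x @ y'" "stars x = u ! p - 1"
      "length (filter is_LPar x) = p" "\<forall>a \<in> set y'. is_Star a"
    by blast
  have "u ! p - 1 + length y' = m * p"
    using stars_insertions[of m u p] x by (simp add: filter_True)
  then obtain a y where "y' = a # y" using \<open>u ! p \<le> m * p\<close> lt by (cases y') auto
  moreover obtain s l where "a = Star s l" using x(4) \<open>y' = a # y\<close> by (cases a) auto
  ultimately have y: "y' = Star s l # y" by simp
  have sx: "Suc (stars x) = u ! p" using x(2) lt by simp
  have before: "insertions m v p = insertions m u p"
    by (rule insertions_cong) (use v p in simp)
  have "\<exists>b. insertions m u (p + Suc d) = x @ Star s l # b @ y \<and>
      insertions m v (p + Suc d) = x @ b @ Star s l # y \<and> rotation_block m (Suc p) (Suc d) b"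
    if "p + d < K" for d
    using that
  proof (induction d)
    case 0
    have "v ! p = stars x" using v[of p] p sx by simp
    moreover have "insert_group 0 (letter_group m (Suc p)) y = letter_group m (Suc p) @ y"
      using insert_group_0_stars x(4) y by simp
    ultimately show ?case using rotation_block_group[OF m, of "Suc p"] x(1) y before sx[symmetric]
      by (intro exI[of _ "letter_group m (Suc p)"]) (simp add: insert_group_append_right)
  next
    case (Suc d)
    then obtain b where b: "insertions m u (p + Suc d) = x @ Star s l # b @ y"
      "insertions m v (p + Suc d) = x @ b @ Star s l # y" "rotation_block m (Suc p) (Suc d) b"
      by auto
    let ?k = "p + Suc d"
    let ?c = "u ! ?k - u ! p" and ?g = "letter_group m (Suc ?k)"
    have k: "?k < K" "?k < length u" using Suc.prems p by auto
    have ge: "u ! p \<le> u ! ?k" using mono k by simp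
    have c: "?c < m * Suc d" using inside[of ?k] k ge by simp
    then have cb: "?c < stars b" using b(3) by (simp add: rotation_block_def)
    have "insertions m u (p + Suc (Suc d)) = insert_group (u ! ?k) ?g ((x @ [Star s l]) @ b @ y)"
      using b(1) by simp
    also have "\<dots> = (x @ [Star s l]) @ insert_group ?c ?g (b @ y)"
      using ge sx by (subst insert_group_append_right) simp_all
    finally have 1: "insertions m u (p + Suc (Suc d)) = x @ Star s l # insert_group ?c ?g b @ y"
      using cb by (simp add: insert_group_append_inside)
    have "insertions m v (p + Suc (Suc d)) = insert_group (u ! ?k - 1) ?g (x @ b @ Star s l # y)"
      using b(2) v[of ?k] k by simp
    also have "\<dots> = x @ insert_group (u ! ?k - 1 - stars x) ?g (b @ Star s l # y)"
      using ge sx by (subst insert_group_append_right) simp_all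
    also have "u ! ?k - 1 - stars x = ?c" using sx by simp
    finally have 2: "insertions m v (p + Suc (Suc d)) = x @ insert_group ?c ?g b @ Star s l # y"
      using cb by (simp add: insert_group_append_inside)
    show ?case using 1 2 rotation_block_insert_group[OF b(3) c] by blast
  qed
  from this[of "K - p - 1"] p obtain b where b: "insertions m u K = x @ Star s l # b @ y"
      "insertions m v K = x @ b @ Star s l # y" "rotation_block m (Suc p) (K - p) b"
    by (auto simp: Suc_diff_Suc)
  have "\<exists>y. insertions m u (K + d) = x @ Star s l # b @ y \<and>
      insertions m v (K + d) = x @ b @ Star s l # y" if "K + d \<le> length u" for d
    using that
  proof (induction d)
    case 0
    then show ?case using b by auto
  next
    case (Suc d)
    then obtain y where y: "insertions m u (K + d) = (x @ Star s l # b) @ y"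
      "insertions m v (K + d) = (x @ b @ [Star s l]) @ y" by auto
    have "u ! p + m * (K - p) \<le> u ! (K + d)"
      using outside mono[of K "K + d"] Suc.prems by simp
    then have ge: "stars (x @ Star s l # b) \<le> u ! (K + d)"
      using b(3) sx by (simp add: rotation_block_def)
    then have ge': "stars (x @ b @ [Star s l]) \<le> u ! (K + d)" by simp
    have "stars (x @ b @ [Star s l]) = stars (x @ Star s l # b)" by simp
    moreover have "v ! (K + d) = u ! (K + d)" using v Suc.prems by simp
    ultimately show ?case
      using y insert_group_append_right[OF ge] insert_group_append_right[OF ge'] by auto
  qed
  from this[of "length u - K"] p x(3) b(3) show ?thesis by fastforce
qed

section \<open>Reading the rotation off the words\<close>

text \<open>The rotation of the tuple inspects the symbol to the left of a left parenthesis in the full word.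
  The word of a nonempty block comes directly after the left parenthesis or a star of the enclosing
  letter, so this symbol survives the erasure of right parentheses.\<close>

lemma alpha_star_no_RPar_LPar:
  "successively (\<lambda>a b. is_RPar a \<longrightarrow> \<not> is_LPar b) (alpha_star w)"
proof (induction w rule: length_induct)
  case (1 w)
  let ?S = "successively (\<lambda>a b. is_RPar a \<longrightarrow> \<not> is_LPar b)"
  show ?case
  proof (cases "w = []")
    case False
    let ?r = "Min (set w)"
    have "?S (alpha_star b)" if "b \<in> set (blocks ?r w)" for b
      using 1 blocks_length_less[OF _ that] False by simp
    then have "?S (join ?r bs)" if "set bs \<subseteq> set (blocks ?r w)" for bs
      using that by (induction bs) (auto simp: successively_append_iff successively_Cons)
    then show ?thesis using False
      by (auto simp: alpha_star_join successively_append_iff successively_Cons)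
  qed (simp add: alpha_star_Nil)
qed

lemma nth_pos_append:
  assumes "Q a" "length (filter Q x) = k"
  shows "nth_pos Q (Suc k) (x @ a # y) = length x"
proof -
  have "[0..<length (x @ a # y)] = [0..<length x] @ length x # [Suc (length x)..<length (x @ a # y)]"
    using upt_add_eq_append[of 0 "length x" "Suc (length y)"]
    by (simp add: upt_conv_Cons del: upt_Suc)
  moreover have "length (filter (\<lambda>j. Q ((x @ a # y) ! j)) [0..<length x]) = k"
  proof -
    have "filter (\<lambda>j. Q ((x @ a # y) ! j)) [0..<length x] = filter (\<lambda>j. Q (x ! j)) [0..<length x]"
      by (rule filter_cong) (auto simp: nth_append)
    moreover have "filter Q x = map ((!) x) (filter (\<lambda>j. Q (x ! j)) [0..<length x])"
      using filter_map[of Q "(!) x" "[0..<length x]"] by (simp add: map_nth comp_def)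
    ultimately show ?thesis using assms(2) by (metis length_map)
  qed
  ultimately show ?thesis using assms(1) by (simp add: nth_pos_def nth_append del: upt_Suc)
qed

lemma word_rotation_append:
  assumes "count_list x E = r" "length z = 2 * n"
  shows "word_rotation n (Suc r) (x @ E # z @ y) = x @ z @ E # y"
proof -
  have "length (filter (\<lambda>c. c = E) x) = r"
    using assms(1) by (simp add: count_list_eq_length_filter eq_commute[of _ E])
  then have "nth_pos (\<lambda>c. c = E) (Suc r) (x @ E # z @ y) = length x"
    by (intro nth_pos_append) auto
  then show ?thesis using assms(2) by (simp add: word_rotation_def Let_def)
qed

definition type_I :: "nat \<Rightarrow> psym list \<Rightarrow> step list" where
  "type_I l w = concat (map (type_I_letter l) w)"

lemma type_I_append: "type_I l (x @ y) = type_I l x @ type_I l y"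
  by (simp add: type_I_def)

lemma type_I_Cons: "type_I l (a # y) = type_I_letter l a @ type_I l y"
  by (simp add: type_I_def)

lemma type_I_filter: "type_I l (filter (\<lambda>a. \<not> is_RPar a) w) = type_I l w"
proof (induction w)
  case (Cons a w)
  then show ?case by (cases a) (auto simp: type_I_def)
qed simp

lemma count_list_type_I: "count_list (type_I l w) E = length (filter (has_label l) w)"
proof (induction w)
  case (Cons a w)
  then show ?case by (cases a) (auto simp: type_I_def)
qed (simp add: type_I_def)

lemma length_type_I:
  "length (type_I l w) = length (filter is_LPar w) + length (filter (has_label l) w)"
proof (induction w)
  case (Cons a w)
  then show ?case by (cases a) (auto simp: type_I_def)
qed (simp add: type_I_def)

lemma filter_eq_append_Cons:
  "filter P w = x @ a # y \<Longrightarrow> \<exists>x' y'. w = x' @ a # y' \<and> filter P x' = x \<and> filter P y' = y"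
proof (induction w arbitrary: x)
  case (Cons c w)
  show ?case
  proof (cases "P c \<and> x = []")
    case True
    then show ?thesis using Cons.prems by (intro exI[of _ "[]"] exI[of _ w]) auto
  next
    case False
    define x1 where "x1 = (if P c then tl x else x)"
    have "filter P w = x1 @ a # y" using Cons.prems False by (cases x) (auto simp: x1_def split: if_splits)
    then obtain x' y' where "w = x' @ a # y'" "filter P x' = x1" "filter P y' = y" using Cons.IH by blast
    then show ?thesis using Cons.prems False
      by (intro exI[of _ "c # x'"] exI[of _ y'], cases x) (auto simp: x1_def split: if_splits)
  qed
qed simp

lemma the_position:
  assumes "a \<notin> set x" "a \<notin> set y"
  shows "(THE j. j < length (x @ a # y) \<and> (x @ a # y) ! j = a) = length x"
proof (rule the_equality)
  fix j assume j: "j < length (x @ a # y) \<and> (x @ a # y) ! j = a"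
  show "j = length x"
  proof (rule linorder_cases[of j "length x"])
    assume "j < length x"
    then show ?thesis using j assms(1) by (auto simp: nth_append)
  next
    assume "length x < j"
    then have "(x @ a # y) ! j = y ! (j - length x - 1)" "j - length x - 1 < length y"
      using j by (auto simp: nth_append nth_Cons')
    then show ?thesis using j assms(2) nth_mem by metis
  qed
qed simp

lemma card_positions:
  "card {j. length x \<le> j \<and> j < length x + length z \<and> Q ((x @ z @ y) ! j)} = length (filter Q z)"
proof -
  have "{j. length x \<le> j \<and> j < length x + length z \<and> Q ((x @ z @ y) ! j)}
      = (+) (length x) ` {j. j < length z \<and> Q (z ! j)}" (is "?A = ?f ` ?B")
  proof
    show "?A \<subseteq> ?f ` ?B"
    proof
      fix j assume "j \<in> ?A"
      then show "j \<in> ?f ` ?B"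
        by (intro image_eqI[of _ _ "j - length x"]) (auto simp: nth_append less_diff_conv2 split: if_splits)
    qed
  qed (auto simp: nth_append)
  then show ?thesis by (simp add: card_image length_filter_conv_card)
qed

text \<open>Positions refer to the full word \<open>w\<close>, the decomposition to the word without right parentheses. The
  decomposition is lifted to \<open>w\<close>; distinctness of the symbols makes the star labeled 1 of the letter
  \<open>Suc p\<close> unique, so that it is found at the end of the block.\<close>

lemma tuple_rotation_moves_star:
  assumes w: "filter (\<lambda>a. \<not> is_RPar a) w = x @ Star s l # b @ y"
    and adj: "successively (\<lambda>a b. is_RPar a \<longrightarrow> \<not> is_LPar b) w"
    and dist: "distinct (x @ Star s l # b @ y)"
    and p: "length (filter is_LPar x) = p"
    and b: "rotation_block m (Suc p) d b" and l: "l \<in> {1..m}"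
  shows "tuple_rotation w (Suc p) (map (\<lambda>k. type_I k w) [1..<m + 1])
    = map (\<lambda>k. type_I k (x @ b @ Star s l # y)) [1..<m + 1]"
proof -
  let ?P = "\<lambda>a. \<not> is_RPar a"
  obtain b' where b': "b = LPar (Suc p) # b' @ [Star (Suc p) 1]" using b by (auto simp: rotation_block_def)
  have "filter ?P w = (x @ [Star s l]) @ LPar (Suc p) # b' @ Star (Suc p) 1 # y"
    using w b' by simp
  then obtain x0 t where t: "w = x0 @ LPar (Suc p) # t" "filter ?P x0 = x @ [Star s l]"
      "filter ?P t = b' @ Star (Suc p) 1 # y"
    using filter_eq_append_Cons[of ?P w] by metis
  obtain t1 t2 where t12: "t = t1 @ Star (Suc p) 1 # t2" "filter ?P t1 = b'" "filter ?P t2 = y"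
    using filter_eq_append_Cons[OF t(3)] by blast
  obtain x1 z where x1: "x0 = x1 @ [z]" using t(2) by (cases x0 rule: rev_cases) auto
  \<comment> \<open>The left neighbour of the left parenthesis survives the filter, so it is the star of the decomposition.\<close>
  have "\<not> is_RPar z" using adj unfolding t(1) x1 by (auto simp: successively_append_iff)
  then have z: "z = Star s l" "filter ?P x1 = x" using t(2) x1 by auto
  have w_eq: "w = (x1 @ [Star s l]) @ LPar (Suc p) # t1 @ Star (Suc p) 1 # t2"
    using t(1) t12(1) x1 z(1) by simp
  have filt: "filter is_LPar (filter ?P v) = filter is_LPar v"
    "filter (has_label k) (filter ?P v) = filter (has_label k) v" for v k
    by (auto intro!: filter_cong elim: is_LPar.elims has_label.elims)
  define e where "e = length (x1 @ [Star s l])"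
  have "length (filter is_LPar (x1 @ [Star s l])) = p" using p z(2) filt(1)[of x1] by simp
  then have e: "nth_pos is_LPar (Suc p) w = e"
    unfolding w_eq e_def by (intro nth_pos_append) auto
  have size: "size_of_rotation w e = d"
  proof -
    have we: "w ! e = LPar (Suc p)" unfolding w_eq e_def by (rule nth_append_length)
    let ?h = "(x1 @ [Star s l]) @ LPar (Suc p) # t1"
    have no: "a \<notin> set v" if "a \<notin> set (filter ?P v)" "?P a" for a v using that by simp
    have "Star (Suc p) 1 \<notin> set ?h" "Star (Suc p) 1 \<notin> set t2"
      using dist no[of "Star (Suc p) 1" t1] no[of "Star (Suc p) 1" t2] no[of "Star (Suc p) 1" x1] t12 z(2)
      unfolding b' by auto
    from the_position[OF this]
    have "(THE j. j < length w \<and> w ! j = Star (Suc p) 1) = length ?h" by (simp add: w_eq)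
    then have "size_of_rotation w e = card {j. e \<le> j \<and> j \<le> length ?h \<and> is_LPar (w ! j)}"
      using we by (simp add: size_of_rotation_def)
    also have "{j. e \<le> j \<and> j \<le> length ?h \<and> is_LPar (w ! j)} = {j. length (x1 @ [Star s l]) \<le> j \<and>
        j < length (x1 @ [Star s l]) + length (LPar (Suc p) # t1 @ [Star (Suc p) 1]) \<and>
        is_LPar (((x1 @ [Star s l]) @ (LPar (Suc p) # t1 @ [Star (Suc p) 1]) @ t2) ! j)}"
      by (auto simp: w_eq e_def)
    also have "card \<dots> = length (filter is_LPar (LPar (Suc p) # t1 @ [Star (Suc p) 1]))"
      by (rule card_positions)
    also have "\<dots> = d" using b t12(2) filt(1)[of t1] by (auto simp: rotation_block_def b')
    finally show ?thesis .
  qed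
  have label: "length (filter (has_label l) (take e w)) = Suc (length (filter (has_label l) x))"
    unfolding w_eq e_def using z(2) filt(2)[of l x1] by simp
  have left: "w ! (e - 1) = Star s l"
    by (simp add: w_eq e_def nth_append)
  have word: "word_rotation d (Suc (length (filter (has_label l) x))) (type_I l w)
      = type_I l (x @ b @ Star s l # y)"
  proof -
    have "type_I l w = type_I l x @ E # type_I l b @ type_I l y"
      unfolding type_I_filter[of l w, symmetric] w by (simp add: type_I_append type_I_Cons)
    moreover have "length (type_I l b) = 2 * d"
      using b l by (simp add: length_type_I rotation_block_def)
    ultimately show ?thesis
      using word_rotation_append[OF count_list_type_I] by (simp add: type_I_append type_I_Cons)
  qed
  have other: "type_I k w = type_I k (x @ b @ Star s l # y)" if "k \<noteq> l" for k
    unfolding type_I_filter[of k w, symmetric] w using that by (simp add: type_I_append type_I_Cons)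
  have comp: "map (\<lambda>k. type_I k w) [1..<m + 1] ! (l - 1) = type_I l w"
    using l by (subst nth_map) (auto simp del: upt_Suc)
  have "tuple_rotation w (Suc p) (map (\<lambda>k. type_I k w) [1..<m + 1])
      = (map (\<lambda>k. type_I k w) [1..<m + 1])[l - 1 := type_I l (x @ b @ Star s l # y)]"
    by (simp add: tuple_rotation_def Let_def e left size label comp word del: upt_Suc One_nat_def)
  also have "\<dots> = map (\<lambda>k. type_I k (x @ b @ Star s l # y)) [1..<m + 1]"
    using other l by (intro nth_equalityI) (auto simp: nth_list_update simp del: upt_Suc)
  finally show ?thesis .
qed

lemma alpha_I_eq_insertions:
  assumes "m \<ge> 1" "P \<in> dyck_paths m n"
  shows "filter (\<lambda>a. \<not> is_RPar a) (parens m P) = insertions m (step_seq P) n"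
    and "alpha_I m P = map (\<lambda>k. type_I k (insertions m (step_seq P) n)) [1..<m + 1]"
proof -
  note u = step_seq_dyck[OF assms(2)]
  have "step_seq P ! j \<le> m * j" if "j < n" for j using u(3)[of "Suc j"] that by simp
  then show 1: "filter (\<lambda>a. \<not> is_RPar a) (parens m P) = insertions m (step_seq P) n"
    using core_stirling_word[OF assms(1)] u(2) by (simp add: parens_def core_def)
  show "alpha_I m P = map (\<lambda>k. type_I k (insertions m (step_seq P) n)) [1..<m + 1]"
    unfolding 1[symmetric] type_I_filter by (simp add: alpha_I_def alpha_I_comp_def type_I_def)
qed

theorem theorem4p32:
  fixes m n :: nat and P :: "step list"
  assumes "m \<ge> 1" and "n \<ge> 1" and "P \<in> dyck_paths m n"
  shows "\<forall>i \<in> {2..n}. step_seq P !\<^sub>1 (i - 1) < step_seq P !\<^sub>1 i \<longrightarrow>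
    alpha_I m (path_rotation m n i P) = tuple_rotation (parens m P) i (alpha_I m P)"
proof (intro ballI impI)
  fix i assume i: "i \<in> {2..n}" and lt: "step_seq P !\<^sub>1 (i - 1) < step_seq P !\<^sub>1 i"
  define p where "p = i - 1"
  have ip: "i = Suc p" "0 < p" "p < n" using i by (auto simp: p_def)
  define u where "u = step_seq P"
  define v where "v = seq_rotation m i u"
  define K where "K = rotation_end m u i"
  note u = step_seq_dyck[OF assms(3), folded u_def]
  have bound: "u ! j \<le> m * j" if "j < length u" for j using u(3)[of "Suc j"] u(2) that by simp
  have end_K: "is_rotation_end m u i K"
    unfolding K_def rotation_end_def by (rule theI', rule rotation_end_ex1) (use i u(2) in auto)
  have inside: "u ! k < u ! p + m * (k - p)" if "p < k" "k < K" for k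
  proof -
    have "Suc k \<in> {i+1..K}" using that ip by simp
    then have "u !\<^sub>1 Suc k < u !\<^sub>1 i + m * (Suc k - i)"
      using end_K unfolding is_rotation_end_def by blast
    then show ?thesis using ip by simp
  qed
  have v_nth: "v ! j = (if p \<le> j \<and> j < K then u ! j - 1 else u ! j)" if "j < length u" for j
    using that ip by (simp add: v_def K_def seq_rotation_def Suc_le_eq del: upt_Suc)
  have "\<exists>x s l b y. insertions m u (length u) = x @ Star s l # b @ y \<and>
    insertions m v (length u) = x @ b @ Star s l # y \<and>
    length (filter is_LPar x) = p \<and> rotation_block m (Suc p) (K - p) b"
  proof (rule insertions_rotation[OF assms(1) _ _ _ _ _ bound inside _ v_nth])
    show "K < length u \<Longrightarrow> u ! p + m * (K - p) \<le> u ! K"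
      using end_K ip by (auto simp: is_rotation_end_def)
    show "u ! (p - 1) < u ! p" using lt ip by (simp add: u_def)
  qed (use u ip end_K in \<open>auto simp: is_rotation_end_def\<close>)
  then obtain x s l b y where split: "insertions m u n = x @ Star s l # b @ y"
      "insertions m v n = x @ b @ Star s l # y"
      "length (filter is_LPar x) = p" "rotation_block m (Suc p) (K - p) b"
    unfolding u(2) by blast
  have "Star s l \<in> set (insertions m u n)" by (simp add: split(1))
  then have l: "l \<in> {1..m}" using set_insertions[of m u n] by auto
  note aP = alpha_I_eq_insertions[OF assms(1,3), folded u_def]
  have w: "filter (\<lambda>a. \<not> is_RPar a) (parens m P) = x @ Star s l # b @ y" using aP(1) split(1) by simp
  have "successively (\<lambda>a b. is_RPar a \<longrightarrow> \<not> is_LPar b) (parens m P)"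
    unfolding parens_def by (rule alpha_star_no_RPar_LPar)
  moreover have "distinct (x @ Star s l # b @ y)" using distinct_insertions[of m u n] split(1) by simp
  ultimately have "tuple_rotation (parens m P) i (map (\<lambda>k. type_I k (parens m P)) [1..<m + 1])
      = map (\<lambda>k. type_I k (x @ b @ Star s l # y)) [1..<m + 1]"
    using tuple_rotation_moves_star[OF w _ _ split(3,4) l] ip(1) by blast
  moreover have "alpha_I m P = map (\<lambda>k. type_I k (parens m P)) [1..<m + 1]"
    by (simp add: alpha_I_def alpha_I_comp_def type_I_def)
  moreover have "alpha_I m (path_rotation m n i P) = map (\<lambda>k. type_I k (insertions m v n)) [1..<m + 1]"
    using alpha_I_eq_insertions(2)[OF assms(1) path_rotation_correct(1)[OF assms(3) i lt]]
      path_rotation_correct(2)[OF assms(3) i lt] by (simp add: v_def u_def)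
  ultimately show "alpha_I m (path_rotation m n i P) = tuple_rotation (parens m P) i (alpha_I m P)"
    by (simp add: split(2))
qed

end
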